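(* Let $G$ be an $n\times n$ grid with $n$ even. Every initial configuration of $k\ge3$ robots on distinct nodes of $G$ in which exactly three corners of the minimum enclosing square are occupied is gatherable despite at most one crash fault.
   Context: Model. The grid is the anonymous grid graph. A configuration is $f:V(G)\to\{0,1,2\}$ ($0$ empty, $1$ singleton, $2$ multiplicity). Robots are anonymous, identical, oblivious, cannot communicate, share no coordinate system, orientation or chirality, run the same deterministic algorithm in Look–Compute–Move cycles (snapshot of the whole configuration with weak multiplicity detection; decision; instantaneous move to an adjacent node or stay), fully asynchronously (finite but unbounded adversarial delays; every non-crashed robot activated infinitely often). At most one robot may crash at an adversarial time (stops forever, stays visible, indistinguishable). Gatherable despite at most one crash fault: some such algorithm guarantees in every execution with at most one crash that after finite time all non-crashed robots are on one node and remain there. Minimum enclosing square: smallest square subgrid with the same geometric center as the grid containing all occupied nodes; its corners are its four corner nodes. *)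

theory Defs
  imports Main
begin

type_synonym node = "nat \<times> nat"

definition grid :: "nat \<Rightarrow> node set" where
  "grid n = {..<n} \<times> {..<n}"

definition grid_adj :: "node \<Rightarrow> node \<Rightarrow> bool" where
  "grid_adj u v \<longleftrightarrow>
     (fst u = fst v \<and> (snd u = Suc (snd v) \<or> snd v = Suc (snd u))) \<or>
     (snd u = snd v \<and> (fst u = Suc (fst v) \<or> fst v = Suc (fst u)))"

text \<open>Automorphisms of the (anonymous) grid graph: the possible local frames of a robot
  (no common coordinate system, orientation or chirality).\<close>
definition grid_aut :: "nat \<Rightarrow> (node \<Rightarrow> node) \<Rightarrow> bool" where
  "grid_aut n \<phi> \<longleftrightarrow> bij_betw \<phi> (grid n) (grid n) \<and>
     (\<forall>u\<in>grid n. \<forall>v\<in>grid n. grid_adj (\<phi> u) (\<phi> v) \<longleftrightarrow> grid_adj u v)"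

text \<open>Configuration with weak multiplicity detection: 0 empty, 1 singleton, 2 multiplicity.
  Robots are indexed by 0..<k (the indices are only used for the analysis, never by the
  algorithm).\<close>
definition conf :: "nat \<Rightarrow> nat \<Rightarrow> (nat \<Rightarrow> node) \<Rightarrow> node \<Rightarrow> nat" where
  "conf n k pos v = (if v \<notin> grid n then 0 else
     (let c = card {i. i < k \<and> pos i = v} in if c = 0 then 0 else if c = 1 then 1 else 2))"

text \<open>An algorithm maps a snapshot (configuration, expressed in the robot's local frame)
  and the robot's own (local) position to a destination: the same node or an adjacent one.\<close>
type_synonym algorithm = "(node \<Rightarrow> nat) \<Rightarrow> node \<Rightarrow> node"

definition valid_alg :: "nat \<Rightarrow> algorithm \<Rightarrow> bool" where
  "valid_alg n A \<longleftrightarrow> (\<forall>g q. q \<in> grid n \<longrightarrow>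
      A g q \<in> grid n \<and> (A g q = q \<or> grid_adj q (A g q)))"

text \<open>Destination computed by a robot at position p, looking at configuration f through
  the local frame phi (an automorphism chosen by the adversary), translated back to
  global nodes.\<close>
definition dest :: "nat \<Rightarrow> algorithm \<Rightarrow> (node \<Rightarrow> node) \<Rightarrow> (node \<Rightarrow> nat) \<Rightarrow> node \<Rightarrow> node" where
  "dest n A \<phi> f p =
     the_inv_into (grid n) \<phi>
       (A (\<lambda>v. if v \<in> grid n then f (the_inv_into (grid n) \<phi> v) else 0) (\<phi> p))"

text \<open>Global state: positions and, for each robot, the pending destination computed at its
  last Look (None = the robot is between cycles, i.e. ready to Look).\<close>
type_synonym state = "(nat \<Rightarrow> node) \<times> (nat \<Rightarrow> node option)"

text \<open>One atomic event of robot i: a Look(+Compute) with an adversarial frame, or the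
  (instantaneous) Move to the previously computed destination.\<close>
definition robot_step :: "nat \<Rightarrow> nat \<Rightarrow> algorithm \<Rightarrow> state \<Rightarrow> state \<Rightarrow> nat \<Rightarrow> bool" where
  "robot_step n k A s s' i \<longleftrightarrow>
     (snd s i = None \<and>
        (\<exists>\<phi>. grid_aut n \<phi> \<and>
           s' = (fst s, (snd s)(i := Some (dest n A \<phi> (conf n k (fst s)) (fst s i))))))
   \<or> (\<exists>d. snd s i = Some d \<and> s' = ((fst s)(i := d), (snd s)(i := None)))"

text \<open>A fully asynchronous execution from initial positions p0: at each time step some robot
  performs an event (the interleaving and hence all delays are chosen by the adversary).\<close>
definition execution :: "nat \<Rightarrow> nat \<Rightarrow> algorithm \<Rightarrow> (nat \<Rightarrow> node) \<Rightarrow>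
    (nat \<Rightarrow> state) \<Rightarrow> (nat \<Rightarrow> nat) \<Rightarrow> bool" where
  "execution n k A p0 \<sigma> act \<longleftrightarrow>
     \<sigma> 0 = (p0, \<lambda>_. None) \<and>
     (\<forall>t. act t < k \<and> robot_step n k A (\<sigma> t) (\<sigma> (Suc t)) (act t))"

text \<open>A robot is non-crashed iff it is activated infinitely often; a robot activated only
  finitely often has crashed (after its last event, possibly between Look and Move; it stays
  visible at its position).\<close>
definition active :: "(nat \<Rightarrow> nat) \<Rightarrow> nat \<Rightarrow> bool" where
  "active act i \<longleftrightarrow> infinite {t. act t = i}"

definition at_most_one_crash :: "nat \<Rightarrow> (nat \<Rightarrow> nat) \<Rightarrow> bool" where
  "at_most_one_crash k act \<longleftrightarrow> card {i. i < k \<and> \<not> active act i} \<le> 1"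

definition gathers :: "nat \<Rightarrow> (nat \<Rightarrow> state) \<Rightarrow> (nat \<Rightarrow> nat) \<Rightarrow> bool" where
  "gathers k \<sigma> act \<longleftrightarrow>
     (\<exists>T v. \<forall>t\<ge>T. \<forall>i<k. active act i \<longrightarrow> fst (\<sigma> t) i = v)"

definition gatherable_one_crash :: "nat \<Rightarrow> nat \<Rightarrow> (nat \<Rightarrow> node) \<Rightarrow> bool" where
  "gatherable_one_crash n k p0 \<longleftrightarrow>
     (\<exists>A. valid_alg n A \<and>
        (\<forall>\<sigma> act. execution n k A p0 \<sigma> act \<and> at_most_one_crash k act \<longrightarrow> gathers k \<sigma> act))"

text \<open>Minimum enclosing square: the concentric square subgrid {a..n-1-a}^2 with largest a
  (a < n div 2) containing all occupied nodes.\<close>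
definition mes_offset :: "nat \<Rightarrow> node set \<Rightarrow> nat" where
  "mes_offset n P = (GREATEST a. a < n div 2 \<and>
      (\<forall>v\<in>P. a \<le> fst v \<and> fst v \<le> n - 1 - a \<and> a \<le> snd v \<and> snd v \<le> n - 1 - a))"

definition mes_corners :: "nat \<Rightarrow> node set \<Rightarrow> node set" where
  "mes_corners n P = (let a = mes_offset n P; b = n - 1 - a in {(a,a), (a,b), (b,a), (b,b)})"

end

theory Submission
  imports Defs
begin

text \<open>Put the occupied corner whose two neighbouring corners are occupied at C = (a,a), with
  neighbours A = (a,b) and B = (b,a) and empty corner D = (b,b). Every robot walks towards C, with
  one exception: while C is not a multiplicity, the robot at A waits as long as there is a robot
  strictly between B and D, and the robot at B waits as long as there is one strictly between
  A and D. C stays recognisable: it is the only corner that can become a multiplicity, and before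
  that a missing robot at A is strictly between C and A while the opposite side BD has no robot
  strictly inside, which fails with respect to any other corner. Progress survives one crash,
  since a blockade of both A and B needs two crashed robots, one on each of the disjoint sides
  BD and AD.\<close>

declare split_paired_All [simp del] split_paired_Ex [simp del]

section \<open>Automorphisms of the grid\<close>

lemma grid_aut_inj: "grid_aut n \<phi> \<Longrightarrow> inj_on \<phi> (grid n)"
  by (simp add: grid_aut_def bij_betw_def)

lemma grid_aut_mem: "grid_aut n \<phi> \<Longrightarrow> v \<in> grid n \<Longrightarrow> \<phi> v \<in> grid n"
  by (auto simp: grid_aut_def bij_betw_def)

lemma grid_aut_adj:
  "grid_aut n \<phi> \<Longrightarrow> u \<in> grid n \<Longrightarrow> v \<in> grid n \<Longrightarrow> grid_adj (\<phi> u) (\<phi> v) \<longleftrightarrow> grid_adj u v"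
  by (simp add: grid_aut_def)

lemma grid_aut_inv_f:
  "grid_aut n \<phi> \<Longrightarrow> v \<in> grid n \<Longrightarrow> the_inv_into (grid n) \<phi> (\<phi> v) = v"
  by (simp add: grid_aut_inj the_inv_into_f_f)

lemma grid_aut_f_inv:
  "grid_aut n \<phi> \<Longrightarrow> v \<in> grid n \<Longrightarrow> \<phi> (the_inv_into (grid n) \<phi> v) = v"
  by (metis bij_betw_def f_the_inv_into_f grid_aut_def)

lemma grid_aut_inv:
  assumes "grid_aut n \<phi>"
  shows "grid_aut n (the_inv_into (grid n) \<phi>)"
proof -
  have b: "bij_betw (the_inv_into (grid n) \<phi>) (grid n) (grid n)"
    using assms bij_betw_the_inv_into grid_aut_def by blast
  then have "the_inv_into (grid n) \<phi> v \<in> grid n" if "v \<in> grid n" for v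
    using that bij_betwE by blast
  then show ?thesis
    using assms b grid_aut_f_inv grid_aut_adj unfolding grid_aut_def by metis
qed

lemma grid_aut_comp:
  assumes "grid_aut n \<phi>" "grid_aut n \<psi>"
  shows "grid_aut n (\<phi> \<circ> \<psi>)"
  using assms bij_betw_trans[of \<psi> "grid n" "grid n" \<phi> "grid n"] grid_aut_mem[OF assms(2)]
  unfolding grid_aut_def by (metis comp_apply)

lemma grid_aut_involution:
  assumes "\<And>v. v \<in> grid n \<Longrightarrow> \<phi> v \<in> grid n" "\<And>v. v \<in> grid n \<Longrightarrow> \<phi> (\<phi> v) = v"
    "\<And>u v. u \<in> grid n \<Longrightarrow> v \<in> grid n \<Longrightarrow> grid_adj (\<phi> u) (\<phi> v) \<longleftrightarrow> grid_adj u v"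
  shows "grid_aut n \<phi>"
  unfolding grid_aut_def using assms by (auto intro: bij_betw_byWitness[where f' = \<phi>])

section \<open>Reflections and the classification of grid automorphisms\<close>

definition flip :: "nat \<Rightarrow> bool \<Rightarrow> bool \<Rightarrow> node \<Rightarrow> node" where
  "flip n s t v = (if s then n - 1 - fst v else fst v, if t then n - 1 - snd v else snd v)"

lemma flip_mem: "v \<in> grid n \<Longrightarrow> flip n s t v \<in> grid n"
  by (auto simp: flip_def grid_def)

lemma flip_flip: "v \<in> grid n \<Longrightarrow> flip n s t (flip n s t v) = v"
  by (auto simp: flip_def grid_def)

lemma grid_aut_flip: "grid_aut n (flip n s t)"
proof (rule grid_aut_involution)
  show "grid_adj (flip n s t u) (flip n s t v) \<longleftrightarrow> grid_adj u v"
    if "u \<in> grid n" "v \<in> grid n" for u v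
    using that by (cases s; cases t; cases u; cases v) (auto simp: flip_def grid_adj_def grid_def)
qed (auto simp: flip_mem flip_flip)

lemma grid_aut_swap: "grid_aut n prod.swap"
  by (rule grid_aut_involution) (auto simp: grid_adj_def grid_def)

text \<open>Induction along antidiagonals. A node with both coordinates positive is one of only two
  common neighbours of its predecessors in the two directions; the other one is already fixed, so
  injectivity decides. A node on the border is the only neighbour of its predecessor not yet
  accounted for.\<close>

lemma grid_aut_fixing_corner:
  assumes aut: "grid_aut n \<theta>" and n: "n \<ge> 2"
    and f00: "\<theta> (0,0) = (0,0)" and f01: "\<theta> (0,1) = (0,1)" and v: "v \<in> grid n"
  shows "\<theta> v = v"
proof -
  have adj: "grid_adj (\<theta> u) (\<theta> v)" if "u \<in> grid n" "v \<in> grid n" "grid_adj u v" for u v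
    using that grid_aut_adj[OF aut] by blast
  have neq: "\<theta> u \<noteq> \<theta> w" if "u \<in> grid n" "w \<in> grid n" "u \<noteq> w" for u w
    using that grid_aut_inj[OF aut] by (meson inj_on_eq_iff)
  have diag: "\<theta> (Suc x, Suc y) = (Suc x, Suc y)"
    if "Suc x < n" "Suc y < n" "\<theta> (x,y) = (x,y)" "\<theta> (Suc x,y) = (Suc x,y)"
      "\<theta> (x,Suc y) = (x,Suc y)" for x y
  proof -
    have "grid_adj (\<theta> (Suc x,y)) (\<theta> (Suc x,Suc y))" "grid_adj (\<theta> (x,Suc y)) (\<theta> (Suc x,Suc y))"
      "\<theta> (Suc x,Suc y) \<noteq> \<theta> (x,y)"
      using that(1,2) by ((intro adj neq; simp add: grid_def grid_adj_def)+)
    then show ?thesis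
      using that(3-) by (cases "\<theta> (Suc x, Suc y)") (auto simp: grid_adj_def)
  qed
  have f10: "\<theta> (1,0) = (1,0)"
  proof -
    have "grid_adj (\<theta> (0,0)) (\<theta> (1,0))" "\<theta> (1,0) \<noteq> \<theta> (0,1)"
      using n by ((intro adj neq; simp add: grid_def grid_adj_def)+)
    then show ?thesis
      using f00 f01 by (cases "\<theta> (1,0)") (auto simp: grid_adj_def)
  qed
  have row: "\<theta> (0,Suc (Suc y)) = (0,Suc (Suc y))"
    if "Suc (Suc y) < n" "\<theta> (0,y) = (0,y)" "\<theta> (0,Suc y) = (0,Suc y)"
       "\<theta> (1,Suc y) = (1,Suc y)" for y
  proof -
    have "grid_adj (\<theta> (0,Suc y)) (\<theta> (0,Suc (Suc y)))" "\<theta> (0,Suc (Suc y)) \<noteq> \<theta> (0,y)"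
      "\<theta> (0,Suc (Suc y)) \<noteq> \<theta> (1,Suc y)"
      using that(1) by ((intro adj neq; simp add: grid_def grid_adj_def)+)
    then show ?thesis
      using that(2-) by (cases "\<theta> (0,Suc (Suc y))") (auto simp: grid_adj_def)
  qed
  have col: "\<theta> (Suc (Suc x),0) = (Suc (Suc x),0)"
    if "Suc (Suc x) < n" "\<theta> (x,0) = (x,0)" "\<theta> (Suc x,0) = (Suc x,0)"
       "\<theta> (Suc x,1) = (Suc x,1)" for x
  proof -
    have "grid_adj (\<theta> (Suc x,0)) (\<theta> (Suc (Suc x),0))" "\<theta> (Suc (Suc x),0) \<noteq> \<theta> (x,0)"
      "\<theta> (Suc (Suc x),0) \<noteq> \<theta> (Suc x,1)"
      using that(1) by ((intro adj neq; simp add: grid_def grid_adj_def)+)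
    then show ?thesis
      using that(2-) by (cases "\<theta> (Suc (Suc x),0)") (auto simp: grid_adj_def)
  qed
  have "\<theta> (x,y) = (x,y)" if "x < n" "y < n" for x y
    using that
  proof (induction "x + y" arbitrary: x y rule: less_induct)
    case less
    have IH: "\<theta> (x',y') = (x',y')" if "x' + y' < x + y" "x' < n" "y' < n" for x' y'
      using less.hyps that by blast
    \<comment> \<open>The border node \<open>(0, y + 2)\<close> needs \<open>(1, y + 1)\<close> from
      its own antidiagonal, which the induction hypothesis does not reach; so nodes off the border
      come first.\<close>
    have D: "\<theta> (x',y') = (x',y')" if "x' + y' \<le> x + y" "x' < n" "y' < n" "0 < x'" "0 < y'" for x' y'
    proof -
      note xy = that
      obtain x0 y0 where "x' = Suc x0" "y' = Suc y0"
        using xy(4,5) by (auto simp: gr0_conv_Suc)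
      then show ?thesis using diag[of x0 y0] IH xy by simp
    qed
    consider "0 < x" "0 < y" | "x = 0" "y = 0" | "x = 0" "y = 1" | "x = 1" "y = 0"
      | y' where "x = 0" "y = Suc (Suc y')" | x' where "y = 0" "x = Suc (Suc x')"
      by (metis One_nat_def gr0_conv_Suc not_gr_zero)
    then show ?case
    proof cases
      case 5
      then show ?thesis using row[of y'] IH D[of 1 "Suc y'"] less.prems n by simp
    next
      case 6
      then show ?thesis using col[of x'] IH D[of "Suc x'" 1] less.prems n by simp
    qed (use D f00 f01 f10 less.prems in auto)
  qed
  then show ?thesis using v by (auto simp: grid_def)
qed

text \<open>Three distinct neighbours of the image would pull back to three neighbours of
  \<open>(0,0)\<close>, which has only two; every node that is not a corner has three.\<close>

lemma grid_aut_corner: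
  assumes aut: "grid_aut n \<theta>" and n: "n \<ge> 2" and xy: "\<theta> (0,0) = (x,y)"
  shows "(x = 0 \<or> x = n - 1) \<and> (y = 0 \<or> y = n - 1)"
proof -
  have xyn: "x < n" "y < n"
    using grid_aut_mem[OF aut, of "(0,0)"] xy n by (simp_all add: grid_def)
  have nb: "w = \<theta> (0,1) \<or> w = \<theta> (1,0)" if "w \<in> grid n" "grid_adj (x,y) w" for w
  proof -
    define u where "u = the_inv_into (grid n) \<theta> w"
    have u: "u \<in> grid n" "\<theta> u = w"
      unfolding u_def by (rule grid_aut_mem[OF grid_aut_inv[OF aut] that(1)], rule grid_aut_f_inv[OF aut that(1)])
    have "(0,0) \<in> grid n" using n by (simp add: grid_def)
    from grid_aut_adj[OF aut this u(1)] have "grid_adj (0,0) u"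
      using that(2) by (simp only: u(2) xy)
    then have "u = (0,1) \<or> u = (1,0)" by (cases u) (auto simp: grid_adj_def)
    then show ?thesis using u by blast
  qed
  have three: False if "w1 \<in> grid n" "w2 \<in> grid n" "w3 \<in> grid n" "grid_adj (x,y) w1"
      "grid_adj (x,y) w2" "grid_adj (x,y) w3" "w1 \<noteq> w2" "w1 \<noteq> w3" "w2 \<noteq> w3" for w1 w2 w3
    using nb[OF that(1,4)] nb[OF that(2,5)] nb[OF that(3,6)] that(7-) by auto
  have "x = 0 \<or> x = n - 1"
  proof (rule ccontr)
    assume "\<not> ?thesis"
    then obtain z where "x = Suc z" "Suc x < n" using xyn by (cases x) auto
    then show False
      using three[of "(x - 1,y)" "(x + 1,y)" "(x, if y = 0 then 1 else y - 1)"] xyn n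
      by (cases y) (auto simp: grid_def grid_adj_def)
  qed
  moreover have "y = 0 \<or> y = n - 1"
  proof (rule ccontr)
    assume "\<not> ?thesis"
    then obtain z where "y = Suc z" "Suc y < n" using xyn by (cases y) auto
    then show False
      using three[of "(x,y - 1)" "(x,y + 1)" "(if x = 0 then 1 else x - 1,y)"] xyn n
      by (cases x) (auto simp: grid_def grid_adj_def)
  qed
  ultimately show ?thesis by blast
qed

text \<open>A flip brings the image of \<open>(0,0)\<close> back to \<open>(0,0)\<close>. Then
  \<open>(0,1)\<close> goes to \<open>(0,1)\<close> or \<open>(1,0)\<close>, and the composite,
  followed by a swap in the second case, is the identity on the grid.\<close>

lemma grid_aut_cases:
  assumes aut: "grid_aut n \<theta>" and n: "n \<ge> 2"
  obtains s t where "\<And>v. v \<in> grid n \<Longrightarrow> \<theta> v = flip n s t v"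
  | s t where "\<And>v. v \<in> grid n \<Longrightarrow> \<theta> v = flip n s t (prod.swap v)"
proof -
  obtain x y where xy: "\<theta> (0,0) = (x,y)" by (cases "\<theta> (0,0)")
  let ?\<rho> = "flip n (x \<noteq> 0) (y \<noteq> 0)"
  have \<rho>0: "(?\<rho> \<circ> \<theta>) (0,0) = (0,0)"
    using grid_aut_corner[OF aut n xy] xy by (auto simp: flip_def)
  have autr: "grid_aut n (?\<rho> \<circ> \<theta>)" by (intro grid_aut_comp grid_aut_flip aut)
  have unflip: "\<theta> v = ?\<rho> w" if "v \<in> grid n" "?\<rho> (\<theta> v) = w" for v w
    using that flip_flip grid_aut_mem[OF aut] by metis
  have "grid_adj ((?\<rho> \<circ> \<theta>) (0,0)) ((?\<rho> \<circ> \<theta>) (0,1))"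
    using grid_aut_adj[OF autr, of "(0,0)" "(0,1)"] n by (auto simp: grid_def grid_adj_def)
  then consider "(?\<rho> \<circ> \<theta>) (0,1) = (0,1)" | "(?\<rho> \<circ> \<theta>) (0,1) = (1,0)"
    unfolding \<rho>0 by (cases "(?\<rho> \<circ> \<theta>) (0,1)") (auto simp: grid_adj_def simp del: comp_apply)
  then show ?thesis
  proof cases
    case 1
    then have "\<theta> v = ?\<rho> v" if "v \<in> grid n" for v
      using grid_aut_fixing_corner[OF autr n \<rho>0 1 that] unflip[OF that] by simp
    then show ?thesis by (rule that(1))
  next
    case 2
    have "grid_aut n (prod.swap \<circ> (?\<rho> \<circ> \<theta>))"
      by (intro grid_aut_comp grid_aut_swap autr)
    from grid_aut_fixing_corner[OF this n] have "prod.swap (?\<rho> (\<theta> v)) = v" if "v \<in> grid n" for v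
      using \<rho>0 2 that by simp
    then have "\<theta> v = ?\<rho> (prod.swap v)" if "v \<in> grid n" for v
      using unflip[OF that] that by (metis swap_swap)
    then show ?thesis by (rule that(2))
  qed
qed

section \<open>Snapshots pulled back along an automorphism\<close>

definition pull :: "nat \<Rightarrow> (node \<Rightarrow> node) \<Rightarrow> (node \<Rightarrow> nat) \<Rightarrow> node \<Rightarrow> nat" where
  "pull n \<psi> g = (\<lambda>v. if v \<in> grid n then g (\<psi> v) else 0)"

lemma pull_pull: "grid_aut n \<psi> \<Longrightarrow> pull n \<psi> (pull n \<phi> g) = pull n (\<phi> \<circ> \<psi>) g"
  by (auto simp: pull_def grid_aut_mem)

lemma pull_cong: "(\<And>v. v \<in> grid n \<Longrightarrow> \<phi> v = \<psi> v) \<Longrightarrow> pull n \<phi> g = pull n \<psi> g"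
  by (auto simp: pull_def)

lemma dest_eq:
  "dest n A \<phi> f p =
    the_inv_into (grid n) \<phi> (A (pull n (the_inv_into (grid n) \<phi>) f) (\<phi> p))"
  by (simp add: dest_def pull_def)

section \<open>The gathering algorithm\<close>

text \<open>The canonical frame. \<open>n = Suc (a + b)\<close> makes the square concentric with the
  grid, so that reflecting a coordinate exchanges \<open>a\<close> and \<open>b\<close>.\<close>

locale square =
  fixes n a b :: nat
  assumes ab: "a < b" and n_eq: "n = Suc (a + b)"
begin

text \<open>These predicates only look at the sides CA and BD; composing with
  \<^const>\<open>prod.swap\<close> gives the sides CB and AD.\<close>

definition far :: "(node \<Rightarrow> nat) \<Rightarrow> bool" where
  "far h \<longleftrightarrow> (\<exists>y. a < y \<and> y < b \<and> h (b,y) \<noteq> 0)"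

definition near :: "(node \<Rightarrow> nat) \<Rightarrow> bool" where
  "near h \<longleftrightarrow> (\<exists>y. a < y \<and> y < b \<and> h (a,y) \<noteq> 0)"

definition side :: "(node \<Rightarrow> nat) \<Rightarrow> bool" where
  "side h \<longleftrightarrow> h (a,b) \<noteq> 0 \<or> near h \<and> \<not> far h"

text \<open>Evidence that C lies at \<open>(a,a)\<close>. Without a multiplicity there, each
  neighbouring corner must be occupied, or its absence explained by a robot on its way to C whose
  blocking side has no robot strictly inside.\<close>

definition recognised :: "(node \<Rightarrow> nat) \<Rightarrow> bool" where
  "recognised h \<longleftrightarrow> h (a,a) \<noteq> 0 \<and> h (a,b) \<noteq> 2 \<and> h (b,a) \<noteq> 2 \<and> h (b,b) = 0 \<and>
     (h (a,a) = 2 \<or> side h \<and> side (h \<circ> prod.swap))"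

definition waiting :: "(node \<Rightarrow> nat) \<Rightarrow> node \<Rightarrow> bool" where
  "waiting h q \<longleftrightarrow> h (a,a) \<noteq> 2 \<and> (q = (a,b) \<and> far h \<or> q = (b,a) \<and> far (h \<circ> prod.swap))"

text \<open>Decreasing the larger coordinate keeps robots on the two edges at (b,b) from
  running into the corners (a,b) and (b,a).\<close>
definition step :: "node \<Rightarrow> node \<Rightarrow> bool" where
  "step q d \<longleftrightarrow> snd q \<le> fst q \<and> a < fst q \<and> d = (fst q - 1, snd q) \<or>
     fst q \<le> snd q \<and> a < snd q \<and> d = (fst q, snd q - 1)"

definition move :: "(node \<Rightarrow> nat) \<Rightarrow> node \<Rightarrow> node \<Rightarrow> bool" where
  "move h q d \<longleftrightarrow> (if q = (a,a) \<or> waiting h q then d = q else step q d)"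

text \<open>A snapshot is taken in an unknown frame, so the algorithm searches for an automorphism
  that puts the corner C at (a,a); \<open>recognised_aut\<close> shows that it is unique up to the
  reflection fixing C.\<close>

definition choice :: "(node \<Rightarrow> nat) \<Rightarrow> node \<Rightarrow> node \<Rightarrow> bool" where
  "choice g q e \<longleftrightarrow> (\<exists>\<psi> p d. grid_aut n \<psi> \<and> p \<in> grid n \<and> q = \<psi> p \<and>
     recognised (pull n \<psi> g) \<and> move (pull n \<psi> g) p d \<and> e = \<psi> d)"

text \<open>\<open>SOME\<close> depends only on snapshot and position, so all robots follow one
  deterministic rule. Staying is the default on snapshots that offer no choice, which keeps the rule
  valid on every input.\<close>

definition alg :: algorithm where
  "alg g q = (if Ex (choice g q) then SOME e. choice g q e else q)"

section \<open>Diagonal reflection, uniqueness of C and independence of the frame\<close>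

lemma corners_mem: "(a,a) \<in> grid n" "(a,b) \<in> grid n" "(b,a) \<in> grid n" "(b,b) \<in> grid n"
  by (auto simp: grid_def n_eq)

lemma step_swap: "step (prod.swap q) (prod.swap d) \<longleftrightarrow> step q d"
  by (cases q; cases d) (auto simp: step_def)

lemma not_step_self: "\<not> step q q"
  by (cases q) (auto simp: step_def)

lemma recognised_swap: "recognised (h \<circ> prod.swap) \<longleftrightarrow> recognised h"
  by (auto simp: recognised_def comp_def)

lemma waiting_swap: "waiting (h \<circ> prod.swap) (prod.swap q) \<longleftrightarrow> waiting h q"
  by (cases q) (auto simp: waiting_def comp_def)

lemma move_swap: "move (h \<circ> prod.swap) (prod.swap q) (prod.swap d) \<longleftrightarrow> move h q d"
  unfolding move_def waiting_swap step_swap by (cases q; cases d) auto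

lemma pull_swap: "pull n (\<theta> \<circ> prod.swap) h = pull n \<theta> h \<circ> prod.swap"
  by (auto simp: pull_def grid_def)

lemma step_mem: "step q d \<Longrightarrow> q \<in> grid n \<Longrightarrow> d \<in> grid n \<and> grid_adj q d"
  by (auto simp: step_def grid_def grid_adj_def)

lemma move_mem: "move h q d \<Longrightarrow> q \<in> grid n \<Longrightarrow> d \<in> grid n \<and> (d = q \<or> grid_adj q d)"
  by (auto simp: move_def step_mem split: if_splits)

lemma valid_alg: "valid_alg n alg"
proof -
  have "e \<in> grid n \<and> (e = q \<or> grid_adj q e)" if "choice g q e" for g q e
    using that unfolding choice_def by (metis grid_aut_mem grid_aut_adj move_mem)
  moreover have "choice g q (alg g q) \<or> alg g q = q" for g q
    unfolding alg_def by (metis someI)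
  ultimately show ?thesis
    unfolding valid_alg_def by metis
qed

text \<open>Flipping one coordinate puts C on a corner required not to be a multiplicity and empties
  the corner tested by \<open>side\<close>. Both views then need \<open>near\<close> without
  \<open>far\<close>, but the flip interchanges the two. Flipping both coordinates puts the occupied
  C on a corner required to be empty.\<close>

lemma recognised_flip:
  assumes "recognised h" "recognised (pull n (flip n s t) h)"
  shows "\<not> s \<and> \<not> t"
proof -
  have 1: False if h: "recognised h" "recognised (pull n (flip n True False) h)" for h
  proof -
    let ?h = "pull n (flip n True False) h"
    have p: "?h (a,y) = h (b,y)" "?h (b,y) = h (a,y)" if "y \<le> b" for y
      using that ab by (auto simp: pull_def flip_def grid_def n_eq)
    have "near ?h \<longleftrightarrow> far h"
      using p by (auto simp: near_def far_def)
    then show False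
      using h p[of a] p[of b] ab by (auto simp: recognised_def side_def)
  qed
  have 2: False if h: "recognised h" "recognised (pull n (flip n False True) h)" for h
  proof -
    have "pull n (flip n True False) (h \<circ> prod.swap) = pull n (flip n False True) h \<circ> prod.swap"
      by (auto simp: pull_def flip_def grid_def fun_eq_iff)
    then show False using 1[of "h \<circ> prod.swap"] h by (simp add: recognised_swap)
  qed
  have 3: False if h: "recognised h" "recognised (pull n (flip n True True) h)" for h
    using h by (auto simp: recognised_def pull_def flip_def grid_def n_eq split: if_splits)
  show ?thesis using assms 1 2 3 by (cases s; cases t) auto
qed

text \<open>By the classification \<theta> is a flip, possibly after a swap. Recognition is
  invariant under the swap, so only the trivial flip remains. \<open>pull n id h\<close> is
  \<open>h\<close> set to 0 outside the grid.\<close>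

lemma recognised_aut:
  assumes "grid_aut n \<theta>" "recognised h" "recognised (pull n \<theta> h)"
  obtains "\<And>v. v \<in> grid n \<Longrightarrow> \<theta> v = v" "pull n \<theta> h = pull n id h"
  | "\<And>v. v \<in> grid n \<Longrightarrow> \<theta> v = prod.swap v" "pull n \<theta> h = pull n id h \<circ> prod.swap"
proof -
  have f: "flip n False False v = v" for v by (simp add: flip_def)
  have "n \<ge> 2" using ab n_eq by simp
  from grid_aut_cases[OF assms(1) this] show ?thesis
  proof cases
    case (1 s t)
    then have e: "pull n \<theta> h = pull n (flip n s t) h" by (auto intro: pull_cong)
    then have "\<not> s \<and> \<not> t" using recognised_flip assms by metis
    then have t: "\<theta> v = v" if "v \<in> grid n" for v using 1[OF that] f by simp
    show ?thesis by (rule that(1)) (auto simp: t intro: pull_cong)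
  next
    case (2 s t)
    then have "pull n \<theta> h = pull n (flip n s t \<circ> prod.swap) h" by (auto intro: pull_cong)
    then have "pull n \<theta> h = pull n (flip n s t) h \<circ> prod.swap" by (simp only: pull_swap)
    then have "\<not> s \<and> \<not> t" using recognised_flip assms recognised_swap by metis
    then have t: "\<theta> v = prod.swap v" if "v \<in> grid n" for v using 2[OF that] f by simp
    have "pull n \<theta> h = pull n (id \<circ> prod.swap) h" by (rule pull_cong) (simp add: t)
    then show ?thesis using that(2) t by (simp only: pull_swap)
  qed
qed

text \<open>Removes the adversarial frame \<phi> from the analysis: whatever automorphism the
  algorithm selects, the decision read in the canonical frame \<delta> is one that
  \<open>move\<close> allows.\<close>

lemma dest_move:
  assumes aut: "grid_aut n \<delta>" "grid_aut n \<phi>" and rec: "recognised (pull n \<delta> f)"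
    and p: "p \<in> grid n" and ex: "move (pull n \<delta> f) p d0"
  shows "\<exists>d\<in>grid n. dest n alg \<phi> f (\<delta> p) = \<delta> d \<and> move (pull n \<delta> f) p d"
proof -
  define \<phi>' where "\<phi>' = the_inv_into (grid n) \<phi>"
  define \<delta>' where "\<delta>' = the_inv_into (grid n) \<delta>"
  define g where "g = pull n \<phi>' f"
  define h where "h = pull n \<delta> f"
  have aut': "grid_aut n \<phi>'" "grid_aut n \<delta>'"
    unfolding \<phi>'_def \<delta>'_def using aut by (auto intro: grid_aut_inv)
  have inv: "\<phi>' (\<phi> v) = v" "\<phi> (\<phi>' v) = v" "\<delta>' (\<delta> v) = v" "\<delta> (\<delta>' v) = v"
    if "v \<in> grid n" for v
    unfolding \<phi>'_def \<delta>'_def using that aut by (auto simp: grid_aut_inv_f grid_aut_f_inv)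
  note mem = aut[THEN grid_aut_mem] aut'[THEN grid_aut_mem]
  have gh: "pull n (\<phi> \<circ> \<delta>) g = h"
    unfolding g_def h_def
    by (subst pull_pull) (auto intro!: grid_aut_comp aut pull_cong simp: inv mem)
  have "choice g (\<phi> (\<delta> p)) (\<phi> (\<delta> d0))"
    unfolding choice_def
    by (rule exI[of _ "\<phi> \<circ> \<delta>"], rule exI[of _ p], rule exI[of _ d0])
      (use gh rec p ex aut in \<open>auto simp: h_def intro: grid_aut_comp\<close>)
  then have "choice g (\<phi> (\<delta> p)) (alg g (\<phi> (\<delta> p)))"
    unfolding alg_def by (metis someI)
  then obtain \<psi> q d where \<psi>: "grid_aut n \<psi>" "q \<in> grid n" "\<phi> (\<delta> p) = \<psi> q"
    "recognised (pull n \<psi> g)" "move (pull n \<psi> g) q d" "alg g (\<phi> (\<delta> p)) = \<psi> d"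
    unfolding choice_def by auto
  \<comment> \<open>\<theta> compares the selected frame with \<delta>. Both views are recognised,
    so \<theta> is the identity or the swap, and \<open>move\<close> respects both.\<close>
  define \<theta> where "\<theta> = \<delta>' \<circ> (\<phi>' \<circ> \<psi>)"
  have d: "d \<in> grid n" using move_mem \<psi> by blast
  have \<theta>: "grid_aut n \<theta>" unfolding \<theta>_def by (intro grid_aut_comp aut' \<psi>)
  note mem = mem grid_aut_mem[OF \<psi>(1)]
  have \<theta>h: "pull n \<theta> h = pull n \<psi> g"
    unfolding h_def g_def
    by (simp only: pull_pull \<theta> \<psi>(1)) (auto intro!: pull_cong simp: \<theta>_def inv mem)
  have \<theta>q: "\<theta> q = p"
    unfolding \<theta>_def using \<psi>(3)[symmetric] p by (simp add: inv mem)
  have dest: "dest n alg \<phi> f (\<delta> p) = \<delta> (\<theta> d)"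
    using \<psi>(6) d unfolding dest_eq g_def[unfolded \<phi>'_def, symmetric]
    by (simp add: \<phi>'_def[symmetric] \<theta>_def inv mem)
  have idh: "pull n id h = h" by (auto simp: pull_def h_def)
  have "move h (\<theta> q) (\<theta> d)"
    using \<theta> rec[folded h_def] \<psi>(4)[folded \<theta>h]
  proof (cases rule: recognised_aut)
    case 1
    then show ?thesis using \<psi>(2,5) d \<theta>h idh by simp
  next
    case 2
    then have "move (h \<circ> prod.swap) q d" using \<psi>(5) \<theta>h idh by simp
    then show ?thesis using 2(1) \<psi>(2) d move_swap[of h "prod.swap q" "prod.swap d"] by simp
  qed
  then show ?thesis using \<theta>q dest grid_aut_mem[OF \<theta> d] unfolding h_def by metis
qed

lemma move_total:
  assumes "a \<le> fst q" "a \<le> snd q"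
  shows "\<exists>d. move h q d"
proof (cases "q = (a,a) \<or> waiting h q")
  case False
  then have "a < fst q \<or> a < snd q" using assms by (cases q) auto
  then have "step q (if fst q \<le> snd q then (fst q, snd q - 1) else (fst q - 1, snd q))"
    by (auto simp: step_def)
  with False show ?thesis unfolding move_def by metis
qed (auto simp: move_def)

end

section \<open>The invariant\<close>

lemma conf_nonzero: "v \<in> grid n \<Longrightarrow> conf n k P v \<noteq> 0 \<longleftrightarrow> (\<exists>i<k. P i = v)"
  by (auto simp: conf_def Let_def)

lemma conf_eq_2:
  assumes "v \<in> grid n"
  shows "conf n k P v = 2 \<longleftrightarrow> (\<exists>i<k. \<exists>j<k. i \<noteq> j \<and> P i = v \<and> P j = v)"
proof -
  define c where "c = card {i. i < k \<and> P i = v}"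
  have "conf n k P v = (if c = 0 then 0 else if c = 1 then 1 else 2)"
    using assms unfolding conf_def c_def Let_def by simp
  then have "conf n k P v = 2 \<longleftrightarrow> \<not> c \<le> Suc 0" by auto
  also have "c \<le> Suc 0 \<longleftrightarrow> (\<forall>i\<in>{i. i < k \<and> P i = v}. \<forall>j\<in>{i. i < k \<and> P i = v}. i = j)"
    unfolding c_def by (rule card_le_Suc0_iff_eq) simp
  finally show ?thesis by auto
qed

lemma conf_swap: "conf n k (prod.swap \<circ> P) = conf n k P \<circ> prod.swap"
proof
  fix v :: node
  have "prod.swap (P i) = v \<longleftrightarrow> P i = prod.swap v" for i
    by (metis swap_swap)
  moreover have "v \<in> grid n \<longleftrightarrow> prod.swap v \<in> grid n"
    by (cases v) (auto simp: grid_def)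
  ultimately show "conf n k (prod.swap \<circ> P) v = (conf n k P \<circ> prod.swap) v"
    by (simp add: conf_def)
qed

locale robots = square +
  fixes k rC :: nat
  assumes rC: "rC < k"
begin

text \<open>The part that holds no matter who waits. No step starts at \<open>(a,a)\<close>, so
  \<open>rC\<close> stays on C forever; a single admissible robot at each of A and B rules out
  multiplicities there.\<close>

definition core :: "nat \<Rightarrow> nat \<Rightarrow> (nat \<Rightarrow> node) \<Rightarrow> (nat \<Rightarrow> node option) \<Rightarrow> bool" where
  "core rA rB P Q \<longleftrightarrow> P rC = (a,a) \<and> (\<forall>i<k. P i \<in> {a..b} \<times> {a..b} \<and> P i \<noteq> (b,b) \<and>
     (P i = (a,b) \<longrightarrow> i = rA) \<and> (P i = (b,a) \<longrightarrow> i = rB) \<and>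
     (\<forall>d. Q i = Some d \<longrightarrow> d = P i \<or> step (P i) d))"

definition doubled :: "(nat \<Rightarrow> node) \<Rightarrow> bool" where
  "doubled P \<longleftrightarrow> (\<exists>i<k. i \<noteq> rC \<and> P i = (a,a))"

definition far_robot :: "(nat \<Rightarrow> node) \<Rightarrow> bool" where
  "far_robot P \<longleftrightarrow> (\<exists>i<k. \<exists>y. a < y \<and> y < b \<and> P i = (b,y))"

text \<open>The second disjunct covers a robot that has decided to leave its corner but has not
  moved yet.\<close>

definition guarded :: "nat \<Rightarrow> (nat \<Rightarrow> node) \<Rightarrow> (nat \<Rightarrow> node option) \<Rightarrow> bool" where
  "guarded r P Q \<longleftrightarrow> fst (P r) = a \<and>
     (P r \<noteq> (a,b) \<or> (\<exists>d. Q r = Some d \<and> d \<noteq> (a,b)) \<longrightarrow> doubled P \<or> \<not> far_robot P)"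

definition invariant :: "nat \<Rightarrow> nat \<Rightarrow> (nat \<Rightarrow> node) \<Rightarrow> (nat \<Rightarrow> node option) \<Rightarrow> bool" where
  "invariant rA rB P Q \<longleftrightarrow> core rA rB P Q \<and> guarded rA P Q \<and>
     guarded rB (prod.swap \<circ> P) (map_option prod.swap \<circ> Q)"

text \<open>A robot event in the canonical frame: the adversarial frame survives only as the freedom
  left by \<open>move\<close>.\<close>

definition event :: "(nat \<Rightarrow> node) \<Rightarrow> (nat \<Rightarrow> node option) \<Rightarrow>
    (nat \<Rightarrow> node) \<Rightarrow> (nat \<Rightarrow> node option) \<Rightarrow> nat \<Rightarrow> bool" where
  "event P Q P' Q' i \<longleftrightarrow>
     Q i = None \<and> P' = P \<and> (\<exists>d. move (conf n k P) (P i) d \<and> Q' = Q(i := Some d)) \<or>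
     (\<exists>d. Q i = Some d \<and> P' = P(i := d) \<and> Q' = Q(i := None))"

section \<open>Symmetry, recognition and preservation of the invariant\<close>

lemma core_swap:
  assumes "core rA rB P Q"
  shows "core rB rA (prod.swap \<circ> P) (map_option prod.swap \<circ> Q)"
proof -
  have e: "prod.swap p = (x,y) \<longleftrightarrow> p = (y,x)" for p :: node and x y by (cases p) auto
  show ?thesis using assms unfolding core_def
    by (auto simp: e mem_Times_iff) (metis step_swap swap_simp)
qed

lemma event_swap:
  assumes "event P Q P' Q' i"
  shows "event (prod.swap \<circ> P) (map_option prod.swap \<circ> Q)
    (prod.swap \<circ> P') (map_option prod.swap \<circ> Q') i"
  using assms unfolding event_def[of P]
proof (elim disjE exE conjE)
  fix d
  assume "Q i = None" "P' = P" "move (conf n k P) (P i) d" "Q' = Q(i := Some d)"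
  then show ?thesis
    unfolding event_def conf_swap by (intro disjI1 conjI exI[of _ "prod.swap d"]) (auto simp: move_swap fun_eq_iff)
next
  fix d
  assume "Q i = Some d" "P' = P(i := d)" "Q' = Q(i := None)"
  then show ?thesis
    unfolding event_def by (intro disjI2 exI[of _ "prod.swap d"]) (auto simp: fun_eq_iff)
qed

lemma conf_corner:
  assumes "core rA rB P Q"
  shows "conf n k P (a,a) \<noteq> 0" "conf n k P (a,b) \<noteq> 2" "conf n k P (b,a) \<noteq> 2"
    "conf n k P (b,b) = 0" "conf n k P (a,a) = 2 \<longleftrightarrow> doubled P"
proof -
  show "conf n k P (a,a) \<noteq> 0"
    using assms rC conf_nonzero[OF corners_mem(1)] unfolding core_def by blast
  show "conf n k P (b,b) = 0"
    using assms conf_nonzero[OF corners_mem(4)] unfolding core_def by blast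
  show "conf n k P (a,b) \<noteq> 2" "conf n k P (b,a) \<noteq> 2"
    using assms unfolding conf_eq_2[OF corners_mem(2)] conf_eq_2[OF corners_mem(3)] core_def by blast+
  show "conf n k P (a,a) = 2 \<longleftrightarrow> doubled P"
    using assms rC unfolding conf_eq_2[OF corners_mem(1)] core_def doubled_def by metis
qed

lemma far_conf: "far (conf n k P) \<longleftrightarrow> far_robot P"
proof -
  have "conf n k P (b,y) \<noteq> 0 \<longleftrightarrow> (\<exists>i<k. P i = (b,y))" if "y < b" for y
    using that by (intro conf_nonzero) (simp add: grid_def n_eq)
  then show ?thesis unfolding far_def far_robot_def by blast
qed

text \<open>If \<open>rA\<close> has left its corner, it is still on the side CA and, as C is not
  doubled, strictly inside it; the guard then excludes robots strictly inside BD.\<close>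

lemma side_conf:
  assumes "core rA rB P Q" "guarded rA P Q" "\<not> doubled P" "rA < k" "rA \<noteq> rC"
  shows "side (conf n k P)"
proof (cases "P rA = (a,b)")
  case True
  then show ?thesis
    using assms(4) by (auto simp: side_def conf_nonzero[OF corners_mem(2)] simp del: neq0_conv)
next
  case False
  obtain y where y: "P rA = (a,y)" using assms(2) by (cases "P rA") (auto simp: guarded_def)
  moreover have "y \<noteq> a" using y assms(3-5) by (auto simp: doubled_def)
  ultimately have y': "a < y" "y < b"
    using assms(1,4) False by (force simp: core_def)+
  then have "conf n k P (a,y) \<noteq> 0"
    using y assms(4) ab by (subst conf_nonzero) (auto simp: grid_def n_eq)
  then show ?thesis
    using y' False assms(2,3) far_conf by (auto simp: side_def near_def guarded_def)
qed

lemma doubled_swap: "doubled (prod.swap \<circ> P) \<longleftrightarrow> doubled P"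
proof -
  have "prod.swap p = (a,a) \<longleftrightarrow> p = (a,a)" for p by (cases p) auto
  then show ?thesis by (simp add: doubled_def)
qed

lemma invariant_recognised:
  assumes "invariant rA rB P Q" "rA < k" "rB < k" "rA \<noteq> rC" "rB \<noteq> rC"
  shows "recognised (conf n k P)"
proof -
  have c: "core rA rB P Q" "guarded rA P Q"
    "guarded rB (prod.swap \<circ> P) (map_option prod.swap \<circ> Q)"
    using assms(1) by (auto simp: invariant_def)
  have "side (conf n k P)" "side (conf n k P \<circ> prod.swap)" if "\<not> doubled P"
    using side_conf[OF c(1,2) that] side_conf[OF core_swap[OF c(1)] c(3)] that assms(2-)
    by (simp_all add: doubled_swap conf_swap)
  then show ?thesis
    using conf_corner[OF c(1)] unfolding recognised_def by blast
qed

lemma core_event: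
  assumes c: "core rA rB P Q" and e: "event P Q P' Q' i" and i: "i < k"
  shows "core rA rB P' Q'"
  using e unfolding event_def
proof (elim disjE exE conjE)
  fix d
  assume "P' = P" "move (conf n k P) (P i) d" "Q' = Q(i := Some d)"
  then show ?thesis
    using c by (auto simp: core_def move_def split: if_splits)
next
  fix d
  assume Q: "Q i = Some d" and P': "P' = P(i := d)" "Q' = Q(i := None)"
  have Pi: "P i \<in> {a..b} \<times> {a..b}" "P i \<noteq> (b,b)" "P i = (a,b) \<longrightarrow> i = rA" "P i = (b,a) \<longrightarrow> i = rB"
    "d = P i \<or> step (P i) d" "i = rC \<longrightarrow> P i = (a,a)"
    using c Q i by (auto simp: core_def)
  \<comment> \<open>Inside the square \<open>(a,b)\<close> could be entered only from
    \<open>(a + 1, b)\<close>, and \<open>(b,a)\<close> only from \<open>(b, a + 1)\<close>. There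
    the coordinate \<open>b\<close> is the larger one and decreases instead; if
    \<open>a + 1 = b\<close>, both nodes are the excluded \<open>(b,b)\<close>.\<close>
  have "d \<in> {a..b} \<times> {a..b} \<and> d \<noteq> (b,b) \<and> d \<noteq> (a,b) \<and> d \<noteq> (b,a)" if "step (P i) d"
    using that Pi(1,2) by (cases "P i") (auto simp: step_def)
  moreover have "P i \<noteq> (a,a)" if "step (P i) d"
    using that by (auto simp: step_def)
  ultimately show ?thesis
    using c Pi P' by (auto simp: core_def)
qed

text \<open>The guard holds when \<open>rA\<close> decides to leave, since it was not waiting. It
  persists because a doubled C stays doubled and no robot newly enters the interior of BD.\<close>

lemma guarded_event:
  assumes c: "core rA rB P Q" and g: "guarded rA P Q" and e: "event P Q P' Q' i" and i: "i < k"
    and r: "rA < k"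
  shows "guarded rA P' Q'"
  using e unfolding event_def
proof (elim disjE exE conjE)
  fix d
  assume P': "P' = P" "move (conf n k P) (P i) d" "Q' = Q(i := Some d)"
  have "doubled P \<or> \<not> far_robot P" if "i = rA" "P rA = (a,b)" "d \<noteq> (a,b)"
    using that P'(2) far_conf conf_corner(5)[OF c]
    by (auto simp: move_def waiting_def split: if_splits)
  then show ?thesis
    using g P' by (cases "i = rA") (auto simp: guarded_def)
next
  fix d
  assume Q: "Q i = Some d" and P': "P' = P(i := d)" "Q' = Q(i := None)"
  have Pi: "P i \<in> {a..b} \<times> {a..b}" "P i \<noteq> (b,b)" "d = P i \<or> step (P i) d"
    using c Q i by (auto simp: core_def)
  have "doubled P'" if "doubled P"
    using that P' Pi(3) by (auto simp: doubled_def step_def)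
  moreover have "far_robot P" if far: "far_robot P'"
  proof -
    obtain j y where j: "j < k" "a < y" "y < b" "P' j = (b,y)"
      using far by (auto simp: far_robot_def)
    have "P j = (b,y)"
    proof (cases "j = i")
      case True
      then have "d = (b,y)" using j P' by simp
      \<comment> \<open>A step from the interior of BD decreases the coordinate \<open>b\<close> and
        so leaves the side; only a robot on \<open>(b,b)\<close> could step along it.\<close>
      moreover have "\<not> step (P i) (b,y)"
        using Pi(1,2) j by (cases "P i") (auto simp: step_def)
      ultimately show ?thesis using Pi(3) True by auto
    qed (use j P' in auto)
    then show ?thesis using j by (auto simp: far_robot_def)
  qed
  moreover have "fst (P' rA) = a"
    using g P' Pi(3) by (auto simp: guarded_def step_def)
  ultimately show ?thesis
    using g P' Q by (cases "i = rA") (auto simp: guarded_def)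
qed

lemma invariant_event:
  assumes "invariant rA rB P Q" "event P Q P' Q' i" "i < k" "rA < k" "rB < k"
  shows "invariant rA rB P' Q'"
proof -
  have i: "core rA rB P Q" "guarded rA P Q"
    "guarded rB (prod.swap \<circ> P) (map_option prod.swap \<circ> Q)"
    using assms(1) by (auto simp: invariant_def)
  show ?thesis
    unfolding invariant_def
    using core_event[OF i(1) assms(2,3)] guarded_event[OF i(1,2) assms(2-4)]
      guarded_event[OF core_swap[OF i(1)] i(3) event_swap[OF assms(2)] assms(3,5)] by blast
qed

section \<open>Convergence\<close>

text \<open>Every change of position lowers the sum of all coordinates, so positions are eventually
  constant; then a fresh Look of an active robot tells it to stay.\<close>

context
  fixes P :: "nat \<Rightarrow> nat \<Rightarrow> node" and Q :: "nat \<Rightarrow> nat \<Rightarrow> node option" and act :: "nat \<Rightarrow> nat"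
    and rA rB :: nat
  assumes inv: "\<And>t. invariant rA rB (P t) (Q t)"
    and ev: "\<And>t. event (P t) (Q t) (P (Suc t)) (Q (Suc t)) (act t)"
    and act: "\<And>t. act t < k"
begin

lemma eventually_constant: "\<exists>T. \<forall>t\<ge>T. P t = P T"
proof -
  define S where "S t = (\<Sum>i<k. fst (P t i) + snd (P t i))" for t
  have S: "P (Suc t) = P t \<or> S (Suc t) < S t" for t
  proof (cases "P (Suc t) = P t")
    case False
    then obtain d where d: "Q t (act t) = Some d" "P (Suc t) = (P t)(act t := d)"
      using ev[of t] unfolding event_def by auto
    then have "d \<noteq> P t (act t)" using False by auto
    with d(1) have "step (P t (act t)) d"
      using inv[of t] act[of t] unfolding invariant_def core_def by blast
    then have "fst d + snd d < fst (P t (act t)) + snd (P t (act t))"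
      by (auto simp: step_def)
    then have "S (Suc t) < S t"
      unfolding S_def using act[of t] d(2) by (intro sum_strict_mono_ex1) auto
    then show ?thesis ..
  qed simp
  obtain T where T: "S T \<le> S t" for t
    using ex_has_least_nat[of "\<lambda>_. True" 0 S] by auto
  have "P t = P T" if "t \<ge> T" for t
    using that
  proof (induction t rule: dec_induct)
    case (step t)
    then have "S t = S T" by (simp add: S_def)
    then show ?case using S[of t] T[of "Suc t"] step.IH by auto
  qed simp
  then show ?thesis by blast
qed

text \<open>A pending decision changes only by an event of its own robot, so it survives until the
  first activation from \<open>t\<close> on.\<close>

lemma next_activation:
  assumes "active act i"
  obtains t' where "t' \<ge> t" "act t' = i" "Q t' i = Q t i"
proof -
  have "\<exists>t'. t' \<ge> t \<and> act t' = i"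
  proof (rule ccontr)
    assume "\<not> ?thesis"
    then have "{t'. act t' = i} \<subseteq> {..<t}" by (auto simp: not_le[symmetric])
    then show False using assms finite_subset unfolding active_def by blast
  qed
  then have L: "(LEAST t'. t' \<ge> t \<and> act t' = i) \<ge> t \<and> act (LEAST t'. t' \<ge> t \<and> act t' = i) = i"
    by (rule LeastI_ex)
  define t' where "t' = (LEAST t'. t' \<ge> t \<and> act t' = i)"
  have no: "act s \<noteq> i" if "t \<le> s" "s < t'" for s
    using that not_less_Least unfolding t'_def by blast
  have "Q s i = Q t i" if "t \<le> s" "s \<le> t'" for s
    using that
  proof (induction s rule: dec_induct)
    case (step s)
    then show ?case using ev[of s] no[of s] by (auto simp: event_def)
  qed simp
  then show ?thesis using that L unfolding t'_def[symmetric] by blast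
qed

lemma active_stays:
  assumes T: "\<And>t. t \<ge> T \<Longrightarrow> P t = P T" and i: "active act i"
  shows "move (conf n k (P T)) (P T i) (P T i)"
proof -
  have moved: "Q t i = Some d \<Longrightarrow> act t = i \<Longrightarrow> Q (Suc t) i = None \<and> P (Suc t) i = d" for t d
    using ev[of t] by (auto simp: event_def)
  \<comment> \<open>A decision pending at \<open>T\<close> may rest on an outdated snapshot. It is
    used up first, so that the next Look sees the final positions.\<close>
  obtain t where t: "t \<ge> T" "Q t i = None"
  proof -
    obtain t1 where t1: "t1 \<ge> T" "act t1 = i" using next_activation[OF i] by metis
    then show ?thesis using that[of t1] that[of "Suc t1"] moved[of t1] by (cases "Q t1 i") auto
  qed
  obtain t1 where t1: "t1 \<ge> t" "act t1 = i" "Q t1 i = None"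
    using next_activation[OF i, of t] t(2) by metis
  then obtain d where d: "move (conf n k (P t1)) (P t1 i) d" "Q (Suc t1) i = Some d"
    using ev[of t1] by (auto simp: event_def)
  obtain t2 where t2: "t2 \<ge> Suc t1" "act t2 = i" "Q t2 i = Some d"
    using next_activation[OF i, of "Suc t1"] d(2) by metis
  then have "P (Suc t2) i = d" using moved by blast
  then show ?thesis using d(1) T[of t1] T[of "Suc t2"] t t1 t2 by auto
qed

lemma gathers_at_corner:
  assumes crash: "at_most_one_crash k act" and r: "rA < k" "rB < k" "rA \<noteq> rC" "rB \<noteq> rC" "rA \<noteq> rB"
  shows "\<exists>T. \<forall>t\<ge>T. \<forall>i<k. active act i \<longrightarrow> P t i = (a,a)"
proof -
  obtain T where T: "\<And>t. t \<ge> T \<Longrightarrow> P t = P T" using eventually_constant by blast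
  let ?P = "P T" and ?h = "conf n k (P T)"
  have stay: "?P i = (a,a) \<or> waiting ?h (?P i)" if "active act i" for i
    using active_stays[OF T that] by (auto simp: move_def not_step_self split: if_splits)
  have core: "core rA rB ?P (Q T)" and g: "fst (?P rA) = a" "snd (?P rB) = a"
    using inv[of T] by (auto simp: invariant_def guarded_def)
  have one: "i = j" if "i < k" "j < k" "\<not> active act i" "\<not> active act j" for i j
    using crash that unfolding at_most_one_crash_def
    by (subst (asm) One_nat_def, subst (asm) card_le_Suc0_iff_eq) auto
  have "\<not> waiting ?h (?P i)" for i
  proof
    assume w: "waiting ?h (?P i)"
    then have nd: "\<not> doubled ?P" using conf_corner(5)[OF core] by (simp add: waiting_def)
    \<comment> \<open>C is not doubled, so no robot other than \<open>rC\<close> is on C, and every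
      active one among them must be waiting at A or B.\<close>
    have waits: "waiting ?h (?P j)" if "j < k" "j \<noteq> rC" "active act j" for j
      using stay[OF that(3)] nd that by (auto simp: doubled_def)
    have swapfar: "far (?h \<circ> prod.swap) \<longleftrightarrow> far_robot (prod.swap \<circ> ?P)"
      by (simp add: far_conf flip: conf_swap)
    have A: "\<exists>j<k. \<not> active act j \<and> fst (?P j) = b \<and> a < snd (?P j) \<and> snd (?P j) < b" if far: "far ?h"
    proof -
      obtain j y where j: "j < k" "a < y" "y < b" "?P j = (b,y)"
        using far unfolding far_conf far_robot_def by blast
      then have "j \<noteq> rC" "\<not> waiting ?h (?P j)"
        using core by (auto simp: core_def waiting_def)
      then have "\<not> active act j" using waits j(1) by metis
      then show ?thesis using j by (intro exI[of _ j]) auto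
    qed
    have B: "\<exists>j<k. \<not> active act j \<and> snd (?P j) = b \<and> a < fst (?P j) \<and> fst (?P j) < b"
      if far: "far (?h \<circ> prod.swap)"
    proof -
      obtain j y where j: "j < k" "a < y" "y < b" "prod.swap (?P j) = (b,y)"
        using far unfolding swapfar far_robot_def by auto
      then have e: "?P j = (y,b)" by (metis swap_simp swap_swap)
      then have "j \<noteq> rC" "\<not> waiting ?h (?P j)"
        using core j by (auto simp: core_def waiting_def)
      then have "\<not> active act j" using waits j(1) by metis
      then show ?thesis using j e by (intro exI[of _ j]) auto
    qed
    have both: "far ?h" "far (?h \<circ> prod.swap)"
    proof -
      have "far (?h \<circ> prod.swap)" if f: "far ?h"
      proof -
        \<comment> \<open>The blocking robot has crashed and is not \<open>rB\<close>, whose second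
          coordinate is \<open>a\<close>. Hence \<open>rB\<close> is active and waits at B, which
          requires a robot strictly between A and D.\<close>
        obtain j where j: "j < k" "\<not> active act j" "a < snd (?P j)" using A[OF f] by blast
        then have "active act rB" using one[of j rB] r(2) g(2) by auto
        moreover have "?P rB \<noteq> (a,b)" using g(2) ab by (metis less_irrefl snd_conv)
        ultimately show ?thesis using waits[of rB] r(2,4) unfolding waiting_def by metis
      qed
      moreover have "far ?h" if f: "far (?h \<circ> prod.swap)"
      proof -
        obtain j where j: "j < k" "\<not> active act j" "a < fst (?P j)" using B[OF f] by blast
        then have "active act rA" using one[of j rA] r(1) g(1) by auto
        moreover have "?P rA \<noteq> (b,a)" using g(1) ab by (metis less_irrefl fst_conv)
        ultimately show ?thesis using waits[of rA] r(1,3) unfolding waiting_def by metis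
      qed
      ultimately show "far ?h" "far (?h \<circ> prod.swap)" using w by (auto simp: waiting_def)
    qed
    \<comment> \<open>The two crashed robots differ: one has first coordinate \<open>b\<close>, the
      other a smaller one.\<close>
    show False using A[OF both(1)] B[OF both(2)] one by (metis less_irrefl)
  qed
  then show ?thesis using stay T by metis
qed

end

section \<open>From the canonical frame to executions\<close>

lemma gathering:
  assumes p0: "p0 ` {..<k} \<subseteq> grid n"
    and init: "invariant rA rB (flip n u v \<circ> p0) (\<lambda>_. None)"
    and r: "rA < k" "rB < k" "rA \<noteq> rC" "rB \<noteq> rC" "rA \<noteq> rB"
    and ex: "execution n k alg p0 \<sigma> act" and crash: "at_most_one_crash k act"
  shows "gathers k \<sigma> act"
proof -
  let ?\<delta> = "flip n u v"
  define P where "P t = ?\<delta> \<circ> fst (\<sigma> t)" for t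
  define Q where "Q t = map_option ?\<delta> \<circ> snd (\<sigma> t)" for t
  have st: "robot_step n k alg (\<sigma> t) (\<sigma> (Suc t)) (act t)" and act: "act t < k" for t
    using ex by (auto simp: execution_def)
  have dest_mem: "dest n alg \<phi> f p \<in> grid n" if "grid_aut n \<phi>" "p \<in> grid n" for \<phi> f p
    using valid_alg that grid_aut_mem grid_aut_inv unfolding dest_eq valid_alg_def by meson
  \<comment> \<open>\<open>flip\<close> is an involution only on the grid, so positions and pending
    destinations must be known to stay there.\<close>
  have mem: "\<forall>i<k. fst (\<sigma> t) i \<in> grid n \<and> (\<forall>d. snd (\<sigma> t) i = Some d \<longrightarrow> d \<in> grid n)" for t
  proof (induction t)
    case 0
    then show ?case using p0 ex by (auto simp: execution_def)
  next
    case (Suc t)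
    note IH = Suc
    show ?case
      using st[of t] unfolding robot_step_def
    proof (elim disjE exE conjE)
      fix \<phi>
      define d where "d = dest n alg \<phi> (conf n k (fst (\<sigma> t))) (fst (\<sigma> t) (act t))"
      assume "grid_aut n \<phi>" and s': "\<sigma> (Suc t) = (fst (\<sigma> t), (snd (\<sigma> t))(act t \<mapsto>
        dest n alg \<phi> (conf n k (fst (\<sigma> t))) (fst (\<sigma> t) (act t))))"
      then have "d \<in> grid n" using dest_mem IH act[of t] by (simp add: d_def)
      then show ?thesis using IH s'[folded d_def] by auto
    qed (use IH act[of t] in auto)
  qed
  have unframe: "?\<delta> (P t i) = fst (\<sigma> t) i" if "i < k" for t i
    using mem that by (simp add: P_def flip_flip)
  have conf: "conf n k (P t) = pull n ?\<delta> (conf n k (fst (\<sigma> t)))" for t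
  proof
    fix w
    have "?\<delta> (fst (\<sigma> t) i) = w \<longleftrightarrow> fst (\<sigma> t) i = ?\<delta> w" if "w \<in> grid n" "i < k" for i
      using that mem flip_flip by metis
    then have "{i. i < k \<and> P t i = w} = {i. i < k \<and> fst (\<sigma> t) i = ?\<delta> w}" if "w \<in> grid n"
      using that by (auto simp: P_def)
    then show "conf n k (P t) w = pull n ?\<delta> (conf n k (fst (\<sigma> t))) w"
      by (simp add: conf_def pull_def flip_mem)
  qed
  have event: "event (P t) (Q t) (P (Suc t)) (Q (Suc t)) (act t)"
    if inv: "invariant rA rB (P t) (Q t)" for t
    using st[of t] unfolding robot_step_def
  proof (elim disjE exE conjE)
    fix \<phi>
    assume N: "snd (\<sigma> t) (act t) = None" and \<phi>: "grid_aut n \<phi>"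
      and s': "\<sigma> (Suc t) = (fst (\<sigma> t), (snd (\<sigma> t))(act t \<mapsto>
        dest n alg \<phi> (conf n k (fst (\<sigma> t))) (fst (\<sigma> t) (act t))))"
    have "P t (act t) \<in> {a..b} \<times> {a..b}"
      using inv act[of t] by (auto simp: invariant_def core_def)
    then obtain d0 where d0: "move (conf n k (P t)) (P t (act t)) d0"
      using move_total by (metis atLeastAtMost_iff mem_Times_iff)
    have "P t (act t) \<in> grid n" using mem act[of t] by (simp add: P_def flip_mem)
    from dest_move[OF grid_aut_flip \<phi> _ this] d0 conf unframe[OF act]
    obtain d where d: "d \<in> grid n"
      "dest n alg \<phi> (conf n k (fst (\<sigma> t))) (fst (\<sigma> t) (act t)) = ?\<delta> d"
      "move (conf n k (P t)) (P t (act t)) d"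
      using invariant_recognised[OF inv r(1-4)] by metis
    then show ?thesis
      unfolding event_def using N s'
      by (intro disjI1 conjI exI[of _ d]) (auto simp: P_def Q_def flip_flip fun_eq_iff)
  next
    fix d
    assume "snd (\<sigma> t) (act t) = Some d"
      "\<sigma> (Suc t) = ((fst (\<sigma> t))(act t := d), (snd (\<sigma> t))(act t := None))"
    then show ?thesis
      unfolding event_def
      by (intro disjI2 exI[of _ "?\<delta> d"]) (auto simp: P_def Q_def fun_eq_iff)
  qed
  \<comment> \<open>Invariant and simulation advance together: the invariant at \<open>t\<close>
    makes the step an \<open>event\<close>, which yields the invariant at
    \<open>Suc t\<close>.\<close>
  have inv: "invariant rA rB (P t) (Q t)" for t
  proof (induction t)
    case 0
    have "Q 0 = (\<lambda>_. None)" "P 0 = ?\<delta> \<circ> p0"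
      using ex by (auto simp: P_def Q_def execution_def)
    then show ?case using init by metis
  next
    case (Suc t)
    then show ?case using event invariant_event act r by blast
  qed
  obtain T where "\<forall>t\<ge>T. \<forall>i<k. active act i \<longrightarrow> P t i = (a,a)"
    using gathers_at_corner[OF inv event[OF inv] act crash r] by blast
  then show ?thesis using unframe unfolding gathers_def by metis
qed

end

theorem theorem9:
  fixes n k :: nat and p0 :: "nat \<Rightarrow> nat \<times> nat"
  assumes "even n"
    and "k \<ge> 3"
    and "inj_on p0 {..<k}"
    and "p0 ` {..<k} \<subseteq> grid n"
    and "card (mes_corners n (p0 ` {..<k}) \<inter> p0 ` {..<k}) = 3"
  shows "gatherable_one_crash n k p0"
proof -
  let ?R = "p0 ` {..<k}"
  have "p0 0 \<in> grid n" using assms(2,4) by (auto simp: image_subset_iff)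
  \<comment> \<open>A robot forces \<open>n > 0\<close>, and an even \<open>n\<close> is then at
    least 2; thus 0 is an admissible offset and \<open>GREATEST\<close> is well defined.\<close>
  then have n0: "0 < n div 2" using assms(1) by (cases "p0 0") (auto simp: grid_def elim!: evenE)
  define a where "a = mes_offset n ?R"
  define b where "b = n - 1 - a"
  have "a < n div 2 \<and> (\<forall>v\<in>?R. a \<le> fst v \<and> fst v \<le> n - 1 - a \<and> a \<le> snd v \<and> snd v \<le> n - 1 - a)"
    unfolding a_def mes_offset_def
  proof (rule GreatestI_nat[where b = "n div 2" and k = 0])
    show "0 < n div 2 \<and> (\<forall>v\<in>?R. 0 \<le> fst v \<and> fst v \<le> n - 1 - 0 \<and> 0 \<le> snd v \<and> snd v \<le> n - 1 - 0)"
      using n0 assms(4) by (fastforce simp: grid_def)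
  qed simp
  then have a: "a < n div 2" and box: "\<And>i. i < k \<Longrightarrow> p0 i \<in> {a..b} \<times> {a..b}"
    by (auto simp: b_def mem_Times_iff)
  interpret square n a b
    using a assms(1) by unfold_locales (auto simp: b_def)
  let ?X = "{(a,a), (a,b), (b,a), (b,b)}"
  have "card (?X \<inter> ?R) = 3"
    using assms(5) by (simp add: mes_corners_def a_def b_def Let_def)
  moreover have "card ?X = 4" using ab by simp
  ultimately have "card (?X - ?R) = 1"
    using card_Diff_subset_Int[of ?X ?R] by simp
  then obtain x where x: "?X - ?R = {x}" by (auto simp: card_1_singleton_iff)
  \<comment> \<open>\<open>x\<close> is the only empty corner. Each coordinate in which it equals
    \<open>a\<close> is reflected, which places it at \<open>(b,b)\<close>.\<close>
  define \<delta> where "\<delta> = flip n (fst x = a) (snd x = a)"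
  have \<delta>\<delta>: "\<delta> (\<delta> w) = w" if "w \<in> grid n" for w
    using that by (simp add: \<delta>_def flip_flip)
  have corner: "\<delta> w \<in> ?X" if "w \<in> ?X" for w
    using that n_eq by (auto simp: \<delta>_def flip_def)
  have "x \<in> ?X" using x by blast
  then have \<delta>x: "\<delta> (b,b) = x"
    using ab n_eq by (auto simp: \<delta>_def flip_def)
  have occ: "\<exists>i<k. p0 i = \<delta> w" if "w \<in> ?X" "w \<noteq> (b,b)" for w
  proof -
    have "w \<in> grid n" using that(1) corners_mem by auto
    then have "\<delta> w \<noteq> x" using that(2) \<delta>x \<delta>\<delta> corners_mem by metis
    then show ?thesis using x corner[OF that(1)] by auto
  qed
  obtain rA rB rC where r: "rA < k" "p0 rA = \<delta> (a,b)" "rB < k" "p0 rB = \<delta> (b,a)"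
      "rC < k" "p0 rC = \<delta> (a,a)"
    using occ[of "(a,b)"] occ[of "(b,a)"] occ[of "(a,a)"] ab by auto
  have P: "\<delta> (p0 rA) = (a,b)" "\<delta> (p0 rB) = (b,a)" "\<delta> (p0 rC) = (a,a)"
    using r \<delta>\<delta> corners_mem by auto
  have ne: "rA \<noteq> rC" "rB \<noteq> rC" "rA \<noteq> rB" using P ab by auto
  interpret robots n a b k rC using r by unfold_locales
  have uniq: "i = j" if "i < k" "j < k" "\<delta> (p0 i) = \<delta> (p0 j)" for i j
  proof -
    have "p0 i \<in> grid n" "p0 j \<in> grid n" using that assms(4) by auto
    then have "p0 i = p0 j" using that(3) \<delta>\<delta> by metis
    then show ?thesis using assms(3) that by (auto dest: inj_onD)
  qed
  have range: "\<delta> (p0 i) \<in> {a..b} \<times> {a..b}" if "i < k" for i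
    using box[OF that] n_eq by (auto simp: \<delta>_def flip_def mem_Times_iff)
  have "\<delta> (p0 i) \<noteq> (b,b)" if "i < k" for i
    using that x \<delta>x \<delta>\<delta> assms(4) by (metis Diff_iff imageI image_subset_iff insertI1 lessThan_iff)
  \<comment> \<open>Nothing is pending and \<open>rA\<close>, \<open>rB\<close> are on their
    corners, so both guards hold vacuously.\<close>
  then have "invariant rA rB (\<delta> \<circ> p0) (\<lambda>_. None)"
    using range P uniq r by (simp add: invariant_def core_def guarded_def)
  then show ?thesis
    using gathering[OF assms(4) _ r(1,3) ne] valid_alg
    unfolding gatherable_one_crash_def \<delta>_def by blast
qed

end
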